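(* Let $(X,T)$ be a topological dynamical system, let $d\in\mathbb{N}$, and let $\mathcal{A}=\{p_1,\ldots,p_d\}$ be a family of integral polynomials with $p_i(0)=0$ for $1\le i\le d$. Then $(X,T)$ has exactly one minimal point if and only if the $\mathbb{Z}^2$-system $(N_{\infty}(X,\mathcal{A}),\langle T^{\infty},\sigma\rangle)$ has exactly one minimal point.
   Context: A topological dynamical system $(X,T)$ is a (non-empty) compact metric space $X$ with a homeomorphism $T:X\to X$; more generally $(X,G)$ denotes a compact metric space with a continuous action of a group $G$ by homeomorphisms. A point $x\in X$ is minimal for $(X,G)$ if its orbit closure $\overline{\{gx:g\in G\}}$ contains no proper non-empty closed $G$-invariant subset. An integral polynomial is a polynomial $p$ (with rational coefficients) with $p(\mathbb{Z})\subseteq\mathbb{Z}$. The induced system: points of $(X^d)^{\mathbb{Z}}$ (product topology) are written $\mathbf{x}=(\mathbf{x}_n)_{n\in\mathbb{Z}}$ with $\mathbf{x}_n=(x_n^{(1)},\ldots,x_n^{(d)})\in X^d$. Define $T^{\infty}:(X^d)^{\mathbb{Z}}\to(X^d)^{\mathbb{Z}}$ by $(T^\infty\mathbf{x})_n=(Tx_n^{(1)},\ldots,Tx_n^{(d)})$ and the shift $\sigma$ by $(\sigma\mathbf{x})_n=\mathbf{x}_{n+1}$. For $x\in X$ let $\omega_x^{\mathcal{A}}=\big((T^{p_1(n)}x,\ldots,T^{p_d(n)}x)\big)_{n\in\mathbb{Z}}$, and set $N_{\infty}(X,\mathcal{A})=\overline{\bigcup_{x\in X}\{\sigma^k\omega_x^{\mathcal{A}}:k\in\mathbb{Z}\}}\subseteq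 (X^d)^{\mathbb{Z}}$. This closed set is invariant under the commuting homeomorphisms $T^\infty$ and $\sigma$, so $\langle T^\infty,\sigma\rangle$ acts on it. *)

theory Defs
  imports "HOL-Analysis.Analysis" "HOL-Algebra.Bij" "HOL-Algebra.Generated_Groups"
    "HOL-Computational_Algebra.Polynomial"
begin

definition top_dyn_system :: "'a::metric_space set \<Rightarrow> ('a \<Rightarrow> 'a) \<Rightarrow> bool" where
  "top_dyn_system X T \<longleftrightarrow> X \<noteq> {} \<and> compact X \<and> (\<exists>S. homeomorphism X X T S)"

(* BijGroup X consists of the bijections of X that are "undefined" outside X,
   hence the restrictions to X here and in int_iter. *)
definition group_generated_on :: "'b set \<Rightarrow> ('b \<Rightarrow> 'b) set \<Rightarrow> ('b \<Rightarrow> 'b) set" where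
  "group_generated_on X F = generate (BijGroup X) ((\<lambda>f. restrict f X) ` F)"

definition int_iter :: "'b set \<Rightarrow> ('b \<Rightarrow> 'b) \<Rightarrow> int \<Rightarrow> 'b \<Rightarrow> 'b" where
  "int_iter X f k = restrict f X [^]\<^bsub>BijGroup X\<^esub> k"

definition orbit_closure :: "('b::topological_space \<Rightarrow> 'b) set \<Rightarrow> 'b \<Rightarrow> 'b set" where
  "orbit_closure G x = closure ((\<lambda>g. g x) ` G)"

(* The closure and the closed sets are those of the ambient type; they agree with those of the
   subspace X whenever X is closed, as it is for both systems considered. *)
definition minimal_point :: "'b::topological_space set \<Rightarrow> ('b \<Rightarrow> 'b) set \<Rightarrow> 'b \<Rightarrow> bool" where
  "minimal_point X G x \<longleftrightarrow> x \<in> X \<and>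
     \<not> (\<exists>Y. Y \<subset> orbit_closure G x \<and> Y \<noteq> {} \<and> closed Y \<and> (\<forall>g\<in>G. g ` Y \<subseteq> Y))"

definition integral_poly :: "rat poly \<Rightarrow> bool" where
  "integral_poly p \<longleftrightarrow> (\<forall>n::int. poly p (of_int n) \<in> \<int>)"

(* The floor only changes the type from rat to int when p is an integral polynomial. *)
definition poly_int :: "rat poly \<Rightarrow> int \<Rightarrow> int" where
  "poly_int p n = \<lfloor>poly p (of_int n)\<rfloor>"

definition T_infty :: "('a \<Rightarrow> 'a) \<Rightarrow> (int \<Rightarrow> 'a ^ 'd) \<Rightarrow> (int \<Rightarrow> 'a ^ 'd)" where
  "T_infty T w = (\<lambda>n. \<chi> i. T (w n $ i))"

definition shift :: "(int \<Rightarrow> 'b) \<Rightarrow> (int \<Rightarrow> 'b)" where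
  "shift w = (\<lambda>n. w (n + 1))"

definition omega :: "'a set \<Rightarrow> ('a \<Rightarrow> 'a) \<Rightarrow> ('d \<Rightarrow> rat poly) \<Rightarrow> 'a \<Rightarrow> int \<Rightarrow> 'a ^ 'd" where
  "omega X T p x = (\<lambda>n. \<chi> i. int_iter X T (poly_int (p i) n) x)"

definition N_infty ::
    "'a::metric_space set \<Rightarrow> ('a \<Rightarrow> 'a) \<Rightarrow> ('d::finite \<Rightarrow> rat poly) \<Rightarrow> (int \<Rightarrow> 'a ^ 'd) set" where
  "N_infty X T p = closure (\<Union>x\<in>X. {int_iter UNIV shift k (omega X T p x) | k. True})"

end

theory Submission
  imports Defs
begin

text \<open>A minimal point is the same thing as a point of a minimal set, that is, of an inclusion-minimal
non-empty closed set \<open>M\<close> with \<open>f ` M = M\<close> for all generators \<open>f\<close> (\<open>minimal_point_iff\<close>). So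
there is exactly one minimal point if and only if there is exactly one minimal set and it is a
singleton \<open>{x}\<close>, and then \<open>x\<close> is a fixed point (\<open>unique_minimal_point_iff\<close>). By compactness
and Zorn's lemma, every non-empty closed invariant set contains a minimal set
(\<open>minimal_set_exists\<close>).

Both directions compare minimal sets of \<open>X\<close> with minimal sets of \<open>N_infty X T p\<close> through the
coordinate maps \<open>w \<mapsto> w n $ i\<close>, which intertwine \<open>T_infty T\<close> with \<open>T\<close>.

Suppose that \<open>x\<^sub>0\<close> is the only minimal point of \<open>X\<close>. A minimal set of \<open>N_infty X T p\<close> is
invariant under \<open>T_infty T\<close>, so it contains a set that is minimal for \<open>T_infty T\<close> alone. Each
coordinate map sends this smaller set onto a minimal set of \<open>X\<close> (\<open>minimal_set_image\<close>), hence onto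
\<open>{x\<^sub>0}\<close>. So the smaller set consists of the constant sequence with all entries \<open>x\<^sub>0\<close>, and this
sequence is also fixed by the shift: it is the whole minimal set.

Suppose conversely that \<open>w\<close> is the only minimal point of \<open>N_infty X T p\<close>, and let \<open>M\<close> be a
minimal set of \<open>X\<close>. The sequences in \<open>N_infty X T p\<close> with all entries in \<open>M\<close> form a closed
invariant set, which is non-empty because it contains \<open>omega X T p x\<close> for \<open>x\<close> in \<open>M\<close>; hence it
contains \<open>w\<close>. Since \<open>w\<close> is fixed by \<open>T_infty T\<close>, each of its entries is a fixed point of \<open>T\<close> in
\<open>M\<close>, and minimality gives \<open>M = {w 0 $ i}\<close> for every such \<open>M\<close>.\<close>

section \<open>Minimal sets of families of homeomorphisms\<close>

definition homeo_family :: "'b::t2_space set \<Rightarrow> ('b \<Rightarrow> 'b) set \<Rightarrow> bool" where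
  "homeo_family K F \<longleftrightarrow> compact K \<and> (\<forall>f\<in>F. f ` K = K \<and> inj_on f K \<and> continuous_on K f)"

text \<open>Equality \<open>f ` Y = Y\<close>, rather than inclusion, expresses invariance under the inverses as well,
and so under the whole generated group.\<close>

definition closed_invariant :: "('b::topological_space \<Rightarrow> 'b) set \<Rightarrow> 'b set \<Rightarrow> bool" where
  "closed_invariant F Y \<longleftrightarrow> Y \<noteq> {} \<and> closed Y \<and> (\<forall>f\<in>F. f ` Y = Y)"

definition minimal_set :: "('b::topological_space \<Rightarrow> 'b) set \<Rightarrow> 'b set \<Rightarrow> bool" where
  "minimal_set F M \<longleftrightarrow> closed_invariant F M \<and> (\<forall>Y\<subseteq>M. closed_invariant F Y \<longrightarrow> Y = M)"

lemma minimal_set_singleton: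
  fixes x :: "'b::t2_space"
  assumes "\<And>f. f \<in> F \<Longrightarrow> f x = x"
  shows "minimal_set F {x}"
  using assms by (auto simp: minimal_set_def closed_invariant_def)

lemma homeo_family_subset:
  assumes "homeo_family K F" "closed_invariant F Y" "Y \<subseteq> K"
  shows "homeo_family Y F"
proof -
  have "compact (K \<inter> Y)"
    using assms by (intro compact_Int_closed) (auto simp: homeo_family_def closed_invariant_def)
  then have "compact Y"
    using assms(3) by (simp add: Int_absorb1)
  moreover have "inj_on f Y \<and> continuous_on Y f" if "f \<in> F" for f
    using assms(1,3) that unfolding homeo_family_def
    by (meson inj_on_subset continuous_on_subset)
  ultimately show ?thesis
    using assms(2) by (simp add: homeo_family_def closed_invariant_def)
qed

text \<open>Compactness keeps the intersection of the chain non-empty, and injectivity lets images commute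
with intersections.\<close>

lemma closed_invariant_Inter_chain:
  assumes fam: "homeo_family K F"
    and "C \<noteq> {}" and inv: "\<And>Y. Y \<in> C \<Longrightarrow> closed_invariant F Y" and sub: "\<And>Y. Y \<in> C \<Longrightarrow> Y \<subseteq> K"
    and chain: "\<And>Y Z. Y \<in> C \<Longrightarrow> Z \<in> C \<Longrightarrow> Y \<subseteq> Z \<or> Z \<subseteq> Y"
  shows "closed_invariant F (\<Inter>C)"
proof -
  obtain Y0 where Y0: "Y0 \<in> C"
    using \<open>C \<noteq> {}\<close> by blast
  have "K \<inter> \<Inter>C \<noteq> {}"
  proof (rule compact_imp_fip)
    show "compact K"
      using fam by (simp add: homeo_family_def)
    show "closed Y" if "Y \<in> C" for Y
      using inv[OF that] by (simp add: closed_invariant_def)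
    show "K \<inter> \<Inter>D \<noteq> {}" if D: "finite D" "D \<subseteq> C" for D
    proof (cases "D = {}")
      case True
      then show ?thesis
        using inv[OF Y0] sub[OF Y0] by (auto simp: closed_invariant_def)
    next
      case False
      have "\<Inter>D \<in> D"
      proof (rule finite_Inf_in[OF D(1) False])
        show "inf Y Z \<in> D" if "Y \<in> D" "Z \<in> D" for Y Z
        proof -
          have "Y \<subseteq> Z \<or> Z \<subseteq> Y"
            using chain that D(2) by blast
          then show ?thesis
            using that by (auto simp: Int_absorb1 Int_absorb2)
        qed
      qed
      then have "\<Inter>D \<in> C"
        using D(2) by blast
      then show ?thesis
        using inv[of "\<Inter>D"] sub[of "\<Inter>D"] by (auto simp: closed_invariant_def)
    qed
  qed
  moreover have "closed (\<Inter>C)"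
    using inv by (auto simp: closed_invariant_def)
  moreover have "f ` \<Inter>C = \<Inter>C" if f: "f \<in> F" for f
  proof -
    have "inj_on f K"
      using fam f by (simp add: homeo_family_def)
    then have "f ` (\<Inter>Y\<in>C. Y) = (\<Inter>Y\<in>C. f ` Y)"
      by (rule image_INT) (use sub Y0 in auto)
    also have "\<dots> = (\<Inter>Y\<in>C. Y)"
      using inv f by (auto simp: closed_invariant_def)
    finally show ?thesis
      by simp
  qed
  ultimately show ?thesis
    by (auto simp: closed_invariant_def)
qed

lemma minimal_set_exists:
  assumes fam: "homeo_family K F" and Y: "closed_invariant F Y" "Y \<subseteq> K"
  obtains M where "minimal_set F M" "M \<subseteq> Y"
proof -
  \<comment> \<open>Zorn's lemma is applied to the complements, so that its maximal element is the complement of a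
    minimal set.\<close>
  define A where "A = uminus ` {Z. closed_invariant F Z \<and> Z \<subseteq> Y}"
  have "\<exists>N\<in>A. \<forall>Z\<in>A. N \<subseteq> Z \<longrightarrow> Z = N"
  proof (rule Zorn_Lemma2, rule ballI)
    fix C assume C: "C \<in> chains A"
    show "\<exists>U\<in>A. \<forall>Z\<in>C. Z \<subseteq> U"
    proof (cases "C = {}")
      case True
      then show ?thesis
        using Y(1) by (auto simp: A_def)
    next
      case False
      define D where "D = uminus ` C"
      have D: "closed_invariant F Z \<and> Z \<subseteq> Y" if "Z \<in> D" for Z
        using that chainsD2[OF C] by (auto simp: D_def A_def)
      have "closed_invariant F (\<Inter>D)"
      proof (rule closed_invariant_Inter_chain[OF fam])
        show "D \<noteq> {}"
          using False by (simp add: D_def)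
        show "closed_invariant F Z" "Z \<subseteq> K" if "Z \<in> D" for Z
          using D[OF that] Y(2) by auto
        show "Z \<subseteq> Z' \<or> Z' \<subseteq> Z" if "Z \<in> D" "Z' \<in> D" for Z Z'
          using that chainsD[OF C] unfolding D_def by blast
      qed
      moreover have "\<Inter>D \<subseteq> Y"
      proof -
        obtain Z where "Z \<in> D"
          using False by (auto simp: D_def)
        then show ?thesis
          using D[of Z] by blast
      qed
      ultimately have "- \<Inter>D \<in> A"
        by (auto simp: A_def)
      then show ?thesis
        by (auto simp: D_def intro!: bexI[of _ "- \<Inter>D"])
    qed
  qed
  then obtain M where M: "closed_invariant F M" "M \<subseteq> Y" and max: "\<forall>Z\<in>A. - M \<subseteq> Z \<longrightarrow> Z = - M"
    by (auto simp: A_def)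
  have "minimal_set F M"
    unfolding minimal_set_def
  proof (intro conjI allI impI)
    fix Z assume Z: "Z \<subseteq> M" "closed_invariant F Z"
    then have "- Z \<in> A"
      using M(2) by (auto simp: A_def)
    then have "- Z = - M"
      using max Z(1) by blast
    then show "Z = M"
      by simp
  qed (rule M)
  then show thesis
    using M(2) that by blast
qed

text \<open>Because \<open>\<pi>\<close> intertwines the two maps, the preimage in \<open>M\<close> of an invariant subset \<open>Y\<close> of \<open>\<pi> ` M\<close>
is invariant, so it is all of \<open>M\<close>. That it is mapped onto itself, and not only into itself, uses that
\<open>g\<close> is injective: if \<open>\<pi> (f v)\<close> is in \<open>Y = g ` Y\<close>, then so is \<open>\<pi> v\<close>.\<close>

lemma minimal_set_image:
  fixes \<pi> :: "'b::t2_space \<Rightarrow> 'c::t2_space"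
  assumes M: "minimal_set {f} M" "compact M"
    and cont: "continuous_on UNIV \<pi>"
    and eqv: "\<And>v. v \<in> M \<Longrightarrow> \<pi> (f v) = g (\<pi> v)"
    and inj: "inj_on g (\<pi> ` M)"
  shows "minimal_set {g} (\<pi> ` M)"
  unfolding minimal_set_def
proof (intro conjI allI impI)
  have fM: "f ` M = M" "M \<noteq> {}"
    using M by (auto simp: minimal_set_def closed_invariant_def)
  have "compact (\<pi> ` M)"
    using cont M(2) by (metis compact_continuous_image continuous_on_subset subset_UNIV)
  moreover have "g ` \<pi> ` M = \<pi> ` f ` M"
    using eqv by (force simp: image_image)
  ultimately show "closed_invariant {g} (\<pi> ` M)"
    using fM by (auto simp: closed_invariant_def compact_imp_closed)
  fix Y assume Y: "Y \<subseteq> \<pi> ` M" "closed_invariant {g} Y"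
  define Z where "Z = M \<inter> \<pi> -` Y"
  have "closed Z"
    unfolding Z_def using Y M(2) cont
    by (auto simp: closed_invariant_def compact_imp_closed intro!: closed_Int closed_vimage)
  moreover have "Z \<noteq> {}"
    using Y by (auto simp: Z_def closed_invariant_def)
  moreover have "f ` Z \<subseteq> Z"
    using fM Y eqv by (auto simp: Z_def closed_invariant_def)
  moreover have "Z \<subseteq> f ` Z"
  proof
    fix u assume u: "u \<in> Z"
    then obtain v where v: "v \<in> M" "u = f v"
      using fM by (auto simp: Z_def)
    then have "g (\<pi> v) \<in> g ` Y"
      using u Y(2) eqv by (auto simp: Z_def closed_invariant_def)
    then obtain y where y: "y \<in> Y" "g (\<pi> v) = g y"
      by blast
    then have "\<pi> v = y"
      using inj Y(1) v(1) by (auto dest!: inj_onD)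
    then show "u \<in> f ` Z"
      using v y by (auto simp: Z_def)
  qed
  ultimately have "closed_invariant {f} Z"
    by (auto simp: closed_invariant_def)
  then have "Z = M"
    using M(1) by (auto simp: minimal_set_def Z_def)
  then show "Y = \<pi> ` M"
    using Y(1) by (auto simp: Z_def)
qed

text \<open>One inclusion is continuity; the other holds because \<open>f ` closure A\<close> is compact, hence closed,
and contains \<open>A\<close>.\<close>

lemma image_closure_invariant:
  fixes A :: "'b::t2_space set"
  assumes "compact K" "A \<subseteq> K" "continuous_on K f" "f ` A = A"
  shows "f ` closure A = closure A"
proof
  have sub: "closure A \<subseteq> K"
    using assms by (simp add: closure_minimal compact_imp_closed)
  then have cont: "continuous_on (closure A) f"
    using assms(3) continuous_on_subset by blast
  show "f ` closure A \<subseteq> closure A"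
    using cont by (rule image_closure_subset) (use assms(4) closure_subset in auto)
  have "compact (closure A)"
    using sub assms(1) by (metis closed_closure compact_Int_closed inf.absorb2)
  then have "closed (f ` closure A)"
    using cont by (simp add: compact_continuous_image compact_imp_closed)
  moreover have "A \<subseteq> f ` closure A"
    using assms(4) closure_subset[of A] by blast
  ultimately show "closure A \<subseteq> f ` closure A"
    by (rule closure_minimal[rotated])
qed

section \<open>The group generated by a family of bijections\<close>

lemma restrict_in_BijGroup:
  assumes "bij_betw f K K"
  shows "restrict f K \<in> carrier (BijGroup K)"
  using assms by (simp add: BijGroup_def Bij_def)

lemma BijGroup_apply_mem:
  assumes "g \<in> carrier (BijGroup K)" "x \<in> K"
  shows "g x \<in> K"
  using assms by (auto simp: BijGroup_def dest!: Bij_imp_funcset)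

lemma BijGroup_one_apply: "x \<in> K \<Longrightarrow> \<one>\<^bsub>BijGroup K\<^esub> x = x"
  by (simp add: BijGroup_def)

lemma BijGroup_mult_apply:
  assumes "g \<in> carrier (BijGroup K)" "h \<in> carrier (BijGroup K)" "x \<in> K"
  shows "(g \<otimes>\<^bsub>BijGroup K\<^esub> h) x = g (h x)"
  using assms by (simp add: BijGroup_def compose_def)

lemma BijGroup_inv_apply:
  assumes "g \<in> carrier (BijGroup K)" "x \<in> K"
  shows "(inv\<^bsub>BijGroup K\<^esub> g) (g x) = x"
proof -
  have "((inv\<^bsub>BijGroup K\<^esub> g) \<otimes>\<^bsub>BijGroup K\<^esub> g) x = x"
    by (simp only: group.l_inv[OF group_BijGroup assms(1)] BijGroup_one_apply[OF assms(2)])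
  then show ?thesis
    by (simp only: BijGroup_mult_apply[OF group.inv_closed[OF group_BijGroup assms(1)] assms])
qed

lemma homeo_family_bij:
  assumes "homeo_family K F" "f \<in> F"
  shows "bij_betw f K K"
  using assms by (simp add: homeo_family_def bij_betw_def)

lemma subgroup_group_generated_on:
  assumes "\<And>f. f \<in> F \<Longrightarrow> bij_betw f K K"
  shows "subgroup (group_generated_on K F) (BijGroup K)"
  unfolding group_generated_on_def
  by (rule group.generate_is_subgroup[OF group_BijGroup])
    (use assms restrict_in_BijGroup in blast)

lemma group_generated_on_invariant:
  assumes bij: "\<And>f. f \<in> F \<Longrightarrow> bij_betw f K K" and "Y \<subseteq> K"
  shows "(\<forall>g\<in>group_generated_on K F. g ` Y \<subseteq> Y) \<longleftrightarrow> (\<forall>f\<in>F. f ` Y = Y)"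
proof
  have G: "subgroup (group_generated_on K F) (BijGroup K)"
    using bij by (rule subgroup_group_generated_on)
  assume inv: "\<forall>g\<in>group_generated_on K F. g ` Y \<subseteq> Y"
  show "\<forall>f\<in>F. f ` Y = Y"
  proof (intro ballI equalityI subsetI)
    fix f assume f: "f \<in> F"
    define g where "g = restrict f K"
    have g: "g \<in> group_generated_on K F"
      using f unfolding g_def group_generated_on_def by (auto intro: generate.incl)
    have g': "inv\<^bsub>BijGroup K\<^esub> g \<in> group_generated_on K F"
      using G g by (rule subgroup.m_inv_closed)
    {
      fix y assume "y \<in> f ` Y"
      then show "y \<in> Y"
        using inv g \<open>Y \<subseteq> K\<close> by (force simp: g_def)
    next
      fix y assume y: "y \<in> Y"
      define z where "z = (inv\<^bsub>BijGroup K\<^esub> g) y"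
      have z: "z \<in> Y"
        using inv g' y by (auto simp: z_def)
      have "g z = y"
      proof -
        have "g \<in> carrier (BijGroup K)" "inv\<^bsub>BijGroup K\<^esub> g \<in> carrier (BijGroup K)"
          using subgroup.mem_carrier[OF G] g g' by auto
        then show ?thesis
          using BijGroup_inv_apply[of "inv\<^bsub>BijGroup K\<^esub> g" K y] y \<open>Y \<subseteq> K\<close>
          by (auto simp: z_def group.inv_inv[OF group_BijGroup])
      qed
      then show "y \<in> f ` Y"
        using z \<open>Y \<subseteq> K\<close> by (auto simp: g_def)
    }
  qed
next
  assume inv: "\<forall>f\<in>F. f ` Y = Y"
  have "g ` Y \<subseteq> Y \<and> g \<in> carrier (BijGroup K)"
    if "g \<in> generate (BijGroup K) ((\<lambda>f. restrict f K) ` F)" for g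
    using that
  proof (induction rule: generate.induct)
    case one
    then show ?case
      using group.is_monoid[OF group_BijGroup] \<open>Y \<subseteq> K\<close>
      by (auto simp: BijGroup_one_apply subsetD monoid.one_closed)
  next
    case (incl h)
    then show ?case
    proof -
      obtain f where f: "f \<in> F" "h = restrict f K"
        using incl by blast
      then have "h ` Y = f ` Y"
        using \<open>Y \<subseteq> K\<close> by (intro image_cong) auto
      then show ?thesis
        using f \<open>\<forall>f\<in>F. f ` Y = Y\<close> restrict_in_BijGroup[OF bij[OF f(1)]]
        by (metis order_refl)
    qed
  next
    case (inv h)
    then obtain f where f: "f \<in> F" "h = restrict f K"
      by blast
    then have h: "h \<in> carrier (BijGroup K)"
      using bij by (simp add: restrict_in_BijGroup)
    have "(inv\<^bsub>BijGroup K\<^esub> h) y \<in> Y" if y: "y \<in> Y" for y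
    proof -
      obtain z where z: "z \<in> Y" "y = h z"
        using \<open>\<forall>f\<in>F. f ` Y = Y\<close> f y \<open>Y \<subseteq> K\<close> by (metis imageE restrict_apply' subsetD)
      then show ?thesis
        using BijGroup_inv_apply[OF h] \<open>Y \<subseteq> K\<close> by auto
    qed
    then show ?case
      using h by (auto simp: group.inv_closed[OF group_BijGroup])
  next
    case (eng g h)
    then show ?case
    proof -
      have "(g \<otimes>\<^bsub>BijGroup K\<^esub> h) y = g (h y)" if "y \<in> Y" for y
        using eng that \<open>Y \<subseteq> K\<close> by (intro BijGroup_mult_apply) auto
      then have "(g \<otimes>\<^bsub>BijGroup K\<^esub> h) ` Y = g ` h ` Y"
        by (simp add: image_image)
      also have "\<dots> \<subseteq> Y"
        using eng by blast
      finally show ?thesis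
        using eng monoid.m_closed[OF group.is_monoid[OF group_BijGroup]] by blast
    qed
  qed
  then show "\<forall>g\<in>group_generated_on K F. g ` Y \<subseteq> Y"
    by (simp add: group_generated_on_def)
qed

section \<open>Minimal points and minimal sets\<close>

lemma orbit_closure_closed_invariant:
  assumes fam: "homeo_family K F" and x: "x \<in> K"
  shows "closed_invariant F (orbit_closure (group_generated_on K F) x)"
    and "x \<in> orbit_closure (group_generated_on K F) x"
    and "orbit_closure (group_generated_on K F) x \<subseteq> K"
proof -
  let ?G = "group_generated_on K F"
  let ?O = "(\<lambda>g. g x) ` ?G"
  have bij: "bij_betw f K K" if "f \<in> F" for f
    using homeo_family_bij[OF fam that] .
  have G: "subgroup ?G (BijGroup K)"
    using bij by (rule subgroup_group_generated_on)
  have cpt: "compact K"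
    using fam by (simp add: homeo_family_def)
  have OK: "?O \<subseteq> K"
    using subgroup.mem_carrier[OF G] x by (auto intro: BijGroup_apply_mem)
  have "g ` ?O \<subseteq> ?O" if "g \<in> ?G" for g
  proof -
    have "g (h x) \<in> ?O" if h: "h \<in> ?G" for h
    proof (rule image_eqI)
      show "g (h x) = (g \<otimes>\<^bsub>BijGroup K\<^esub> h) x"
        using subgroup.mem_carrier[OF G] \<open>g \<in> ?G\<close> h x by (simp add: BijGroup_mult_apply)
      show "g \<otimes>\<^bsub>BijGroup K\<^esub> h \<in> ?G"
        using G \<open>g \<in> ?G\<close> h by (rule subgroup.m_closed)
    qed
    then show ?thesis
      by blast
  qed
  then have "\<forall>f\<in>F. f ` ?O = ?O"
    by (intro group_generated_on_invariant[OF bij OK, THEN iffD1] ballI)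
  then have inv: "f ` ?O = ?O" if "f \<in> F" for f
    using that by (rule bspec)
  have one: "x \<in> ?O"
    using BijGroup_one_apply[OF x, symmetric] subgroup.one_closed[OF G] by (rule image_eqI)
  show "x \<in> orbit_closure ?G x"
    unfolding orbit_closure_def by (rule subsetD[OF closure_subset one])
  have "f ` closure ?O = closure ?O" if f: "f \<in> F" for f
  proof (rule image_closure_invariant[OF cpt OK _ inv[OF f]])
    show "continuous_on K f"
      using fam f by (simp add: homeo_family_def)
  qed
  then show "closed_invariant F (orbit_closure ?G x)"
    using one by (auto simp: closed_invariant_def orbit_closure_def)
  show "orbit_closure ?G x \<subseteq> K"
    unfolding orbit_closure_def using OK cpt by (simp add: closure_minimal compact_imp_closed)
qed

text \<open>The orbit closure of \<open>x\<close> is the least closed invariant set that contains \<open>x\<close>. Hence it equals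
any minimal set through \<open>x\<close>.\<close>

lemma minimal_point_iff:
  assumes fam: "homeo_family K F"
  shows "minimal_point K (group_generated_on K F) x \<longleftrightarrow> (\<exists>M. minimal_set F M \<and> M \<subseteq> K \<and> x \<in> M)"
proof -
  let ?G = "group_generated_on K F"
  have inv: "(\<forall>g\<in>?G. g ` Y \<subseteq> Y) \<longleftrightarrow> (\<forall>f\<in>F. f ` Y = Y)" if "Y \<subseteq> K" for Y
    using homeo_family_bij[OF fam] that by (rule group_generated_on_invariant)
  have min: "minimal_point K ?G x \<longleftrightarrow> minimal_set F (orbit_closure ?G x)" if x: "x \<in> K"
  proof -
    have "(\<forall>g\<in>?G. g ` Y \<subseteq> Y) \<longleftrightarrow> (\<forall>f\<in>F. f ` Y = Y)" if "Y \<subseteq> orbit_closure ?G x" for Y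
      using that orbit_closure_closed_invariant(3)[OF fam x] by (intro inv) (rule subset_trans)
    then have "minimal_point K ?G x \<longleftrightarrow>
      \<not> (\<exists>Y. Y \<subset> orbit_closure ?G x \<and> closed_invariant F Y)"
      using x by (simp add: minimal_point_def closed_invariant_def psubset_imp_subset conj_ac
          cong: conj_cong)
    then show ?thesis
      unfolding minimal_set_def psubset_eq
      using orbit_closure_closed_invariant(1)[OF fam x] by metis
  qed
  show ?thesis
  proof
    assume "minimal_point K ?G x"
    moreover from this have "x \<in> K"
      by (simp add: minimal_point_def)
    ultimately show "\<exists>M. minimal_set F M \<and> M \<subseteq> K \<and> x \<in> M"
      using min orbit_closure_closed_invariant[OF fam] by blast
  next
    assume "\<exists>M. minimal_set F M \<and> M \<subseteq> K \<and> x \<in> M"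
    then obtain M where M: "minimal_set F M" "M \<subseteq> K" "x \<in> M"
      by blast
    have "g ` M \<subseteq> M" if "g \<in> ?G" for g
      using inv[OF M(2)] M(1) that by (auto simp: minimal_set_def closed_invariant_def)
    then have "(\<lambda>g. g x) ` ?G \<subseteq> M"
      using M(3) by blast
    then have "orbit_closure ?G x \<subseteq> M"
      unfolding orbit_closure_def
      using M(1) by (simp add: minimal_set_def closed_invariant_def closure_minimal)
    then have "orbit_closure ?G x = M"
      using M orbit_closure_closed_invariant(1)[OF fam] by (auto simp: minimal_set_def)
    then show "minimal_point K ?G x"
      using min M by auto
  qed
qed

lemma unique_minimal_point_iff:
  assumes fam: "homeo_family K F"
  shows "(\<exists>!x. minimal_point K (group_generated_on K F) x) \<longleftrightarrow>
    (\<exists>x\<in>K. minimal_set F {x} \<and> (\<forall>M\<subseteq>K. minimal_set F M \<longrightarrow> M = {x}))"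
    (is "?L \<longleftrightarrow> ?R")
proof
  assume ?L
  then obtain x where x: "minimal_point K (group_generated_on K F) x"
    and uniq: "\<And>y. minimal_point K (group_generated_on K F) y \<Longrightarrow> y = x"
    by (rule ex1E) blast
  have single: "M = {x}" if M: "minimal_set F M" "M \<subseteq> K" for M
  proof -
    have "y = x" if "y \<in> M" for y
      using uniq[of y] M that unfolding minimal_point_iff[OF fam] by blast
    moreover have "M \<noteq> {}"
      using M(1) by (simp add: minimal_set_def closed_invariant_def)
    ultimately show ?thesis
      by blast
  qed
  obtain M where "minimal_set F M" "M \<subseteq> K" "x \<in> M"
    using x unfolding minimal_point_iff[OF fam] by blast
  then have "minimal_set F {x}" "x \<in> K"
    using single[of M] by auto
  then show ?R
    using single by blast
next
  assume ?R
  then obtain x where x: "x \<in> K" "minimal_set F {x}"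
    and single: "\<And>M. M \<subseteq> K \<Longrightarrow> minimal_set F M \<Longrightarrow> M = {x}"
    by blast
  show ?L
    unfolding minimal_point_iff[OF fam]
  proof (rule ex1I[of _ x])
    show "\<exists>M. minimal_set F M \<and> M \<subseteq> K \<and> x \<in> M"
      using x by (intro exI[of _ "{x}"]) simp
  qed (use single in blast)
qed

section \<open>Integer iterates\<close>

lemma int_iter_Suc:
  assumes "bij_betw f K K" "x \<in> K"
  shows "int_iter K f (k + 1) x = f (int_iter K f k x)"
    and "int_iter K f (k + 1) x = int_iter K f k (f x)"
    and "int_iter K f k x \<in> K"
proof -
  let ?f = "restrict f K"
  have f: "?f \<in> carrier (BijGroup K)"
    using assms by (simp add: restrict_in_BijGroup)
  have pow: "?f [^]\<^bsub>BijGroup K\<^esub> k \<in> carrier (BijGroup K)"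
    using f by (rule group.int_pow_closed[OF group_BijGroup])
  show *: "int_iter K f k x \<in> K"
    unfolding int_iter_def using pow assms(2) by (rule BijGroup_apply_mem)
  have "f x \<in> K"
    using assms by (auto simp: bij_betw_def)
  have "?f [^]\<^bsub>BijGroup K\<^esub> (1 + k) = ?f \<otimes>\<^bsub>BijGroup K\<^esub> ?f [^]\<^bsub>BijGroup K\<^esub> k"
    "?f [^]\<^bsub>BijGroup K\<^esub> (k + 1) = ?f [^]\<^bsub>BijGroup K\<^esub> k \<otimes>\<^bsub>BijGroup K\<^esub> ?f"
    using f by (simp_all add: group.int_pow_mult[OF group_BijGroup] group.int_pow_1[OF group_BijGroup])
  then show "int_iter K f (k + 1) x = f (int_iter K f k x)"
    and "int_iter K f (k + 1) x = int_iter K f k (f x)"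
    using BijGroup_mult_apply[OF f pow assms(2)] BijGroup_mult_apply[OF pow f assms(2)] * assms(2)
    by (simp_all add: int_iter_def add.commute)
qed

lemma int_iter_zero: "x \<in> K \<Longrightarrow> int_iter K f 0 x = x"
  by (simp add: int_iter_def BijGroup_def)

lemma int_iter_mem:
  assumes bij: "bij_betw f K K" and "M \<subseteq> K" "f ` M = M" "x \<in> M"
  shows "int_iter K f k x \<in> M"
proof (induction k rule: int_induct[where k = 0])
  case base
  then show ?case
    using assms by (simp add: int_iter_zero subsetD)
next
  case (step1 i)
  have "x \<in> K"
    using assms by blast
  then show ?case
    using step1 int_iter_Suc(1)[OF bij] assms(3) by auto
next
  case (step2 i)
  have x: "x \<in> K"
    using assms by blast
  have "f (int_iter K f (i - 1) x) \<in> f ` M"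
    using step2 int_iter_Suc(1)[OF bij x, of "i - 1"] assms(3) by simp
  then obtain y where "y \<in> M" "f (int_iter K f (i - 1) x) = f y"
    by blast
  then show ?case
    using int_iter_Suc(3)[OF bij x] bij \<open>M \<subseteq> K\<close> by (metis bij_betw_def inj_onD subsetD)
qed

lemma bij_shift: "bij_betw shift UNIV UNIV"
  by (rule bij_betw_byWitness[where f' = "\<lambda>w n. w (n - 1)"]) (auto simp: shift_def)

lemma shift_translate: "shift (\<lambda>n. w (n + k)) = (\<lambda>n. w (n + (k + 1)))"
  by (simp add: shift_def ac_simps)

lemma int_iter_shift: "int_iter UNIV shift k w = (\<lambda>n. w (n + k))"
proof (induction k rule: int_induct[where k = 0])
  case base
  then show ?case
    by (simp add: int_iter_zero)
next
  case (step1 i)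
  then show ?case
    using int_iter_Suc(1)[OF bij_shift, of w i] by (simp add: shift_translate)
next
  case (step2 i)
  have "shift (int_iter UNIV shift (i - 1) w) = shift (\<lambda>n. w (n + (i - 1)))"
    unfolding shift_translate
    using step2 int_iter_Suc(1)[OF bij_shift, of w "i - 1"] by simp
  then show ?case
    using bij_shift by (metis UNIV_I bij_betw_def inj_onD)
qed

section \<open>The induced system\<close>

definition seqs_in :: "'a set \<Rightarrow> (int \<Rightarrow> 'a ^ 'd::finite) set" where
  "seqs_in M = {w. \<forall>n i. w n $ i \<in> M}"

lemma continuous_on_coord:
  "continuous_on S (\<lambda>w :: int \<Rightarrow> ('a::topological_space) ^ 'd::finite. w n $ i)"
  by (intro continuous_on_component continuous_on_subset[OF continuous_on_product_coordinates]) simp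

lemma closed_seqs_in:
  fixes M :: "'a::topological_space set"
  assumes "closed M"
  shows "closed (seqs_in M :: (int \<Rightarrow> 'a ^ 'd::finite) set)"
proof -
  have "seqs_in M = (\<Inter>n. \<Inter>i. (\<lambda>w :: int \<Rightarrow> 'a ^ 'd. w n $ i) -` M)"
    by (auto simp: seqs_in_def)
  then show ?thesis
    using assms by (auto intro!: closed_INT closed_vimage continuous_on_coord)
qed

text \<open>This is Tychonoff's theorem, transferred from functions on the pairs \<open>(n, i)\<close> to sequences of
vectors by currying.\<close>

lemma compact_seqs_in:
  fixes X :: "'a::topological_space set"
  assumes "compact X"
  shows "compact (seqs_in X :: (int \<Rightarrow> 'a ^ 'd::finite) set)"
proof -
  let ?P = "PiE UNIV (\<lambda>_. X) :: (int \<times> 'd \<Rightarrow> 'a) set"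
  let ?h = "\<lambda>f :: int \<times> 'd \<Rightarrow> 'a. (\<lambda>n. \<chi> i. f (n, i))"
  have "compactin (product_topology (\<lambda>_. euclidean) UNIV) ?P"
    using assms by (simp add: compactin_PiE)
  then have "compact ?P"
    by (simp add: euclidean_product_topology)
  moreover have "continuous_on ?P ?h"
    by (intro continuous_on_coordinatewise_then_product continuous_on_vec_lambda
        continuous_on_subset[OF continuous_on_product_coordinates]) simp
  ultimately have "compact (?h ` ?P)"
    by (rule compact_continuous_image[rotated])
  moreover have "?h ` ?P = seqs_in X"
  proof (intro equalityI subsetI)
    fix w :: "int \<Rightarrow> 'a ^ 'd" assume "w \<in> seqs_in X"
    then show "w \<in> ?h ` ?P"
      by (intro image_eqI[where x = "\<lambda>(n, i). w n $ i"]) (auto simp: seqs_in_def)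
  qed (auto simp: seqs_in_def)
  ultimately show ?thesis
    by simp
qed

lemma homeo_family_seqs_in:
  fixes X :: "'a::metric_space set"
  assumes "homeo_family X {T}"
  shows "homeo_family (seqs_in X :: (int \<Rightarrow> 'a ^ 'd::finite) set) {T_infty T, shift}"
proof -
  let ?K = "seqs_in X :: (int \<Rightarrow> 'a ^ 'd) set"
  have T: "T ` X = X" "inj_on T X" "continuous_on X T" "compact X"
    using assms by (auto simp: homeo_family_def)
  have cont: "continuous_on ?K (T_infty T)" "continuous_on ?K shift"
    unfolding T_infty_def shift_def
    by (intro continuous_on_coordinatewise_then_product continuous_on_vec_lambda
        continuous_on_compose2[OF T(3)] continuous_on_coord
        continuous_on_subset[OF continuous_on_product_coordinates];
        force simp: seqs_in_def)+
  have inj: "inj_on (T_infty T) ?K"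
    using T(2) by (auto simp: inj_on_def seqs_in_def T_infty_def fun_eq_iff vec_eq_iff)
  have "T_infty T ` ?K = ?K"
  proof (intro equalityI subsetI)
    fix w assume w: "w \<in> ?K"
    have "w = T_infty T (\<lambda>n. \<chi> i. inv_into X T (w n $ i))"
      using w T(1) by (auto simp: T_infty_def seqs_in_def f_inv_into_f fun_eq_iff vec_eq_iff)
    moreover have "(\<lambda>n. \<chi> i. inv_into X T (w n $ i)) \<in> ?K"
      using w T(1) by (auto simp: seqs_in_def intro!: inv_into_into)
    ultimately show "w \<in> T_infty T ` ?K"
      by (rule image_eqI)
  qed (use T(1) in \<open>auto simp: seqs_in_def T_infty_def\<close>)
  moreover have "shift ` ?K = ?K"
  proof (intro equalityI subsetI)
    fix w assume "w \<in> ?K"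
    then show "w \<in> shift ` ?K"
      by (intro image_eqI[where x = "\<lambda>n. w (n - 1)"]) (auto simp: seqs_in_def shift_def)
  qed (auto simp: seqs_in_def shift_def)
  moreover have "inj_on shift ?K"
    using bij_shift by (auto simp: bij_betw_def intro: inj_on_subset)
  ultimately show ?thesis
    using cont inj compact_seqs_in[OF T(4)] by (auto simp: homeo_family_def)
qed

lemma omega_mem_seqs_in:
  assumes "bij_betw T X X" "M \<subseteq> X" "T ` M = M" "x \<in> M"
  shows "omega X T p x \<in> seqs_in M"
  using int_iter_mem[OF assms] by (simp add: omega_def seqs_in_def)

lemma N_infty_eq:
  "N_infty X T p = closure {\<lambda>n. omega X T p x (n + k) | x k. x \<in> X}"
  unfolding N_infty_def int_iter_shift by (rule arg_cong[of _ _ closure]) blast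

lemma omega_mem_N_infty:
  assumes "x \<in> X"
  shows "omega X T p x \<in> N_infty X T p"
proof -
  have "omega X T p x \<in> {\<lambda>n. omega X T p x (n + k) | x k. x \<in> X}"
    using assms by (intro CollectI exI[of _ x] exI[of _ 0]) simp
  then show ?thesis
    unfolding N_infty_eq by (rule subsetD[OF closure_subset])
qed

text \<open>On the generating sequences, \<open>T_infty T\<close> moves the base point from \<open>x\<close> to \<open>T x\<close> and the shift
raises the offset \<open>k\<close> by one; both operations are onto.\<close>

lemma N_infty_closed_invariant:
  fixes X :: "'a::metric_space set" and p :: "'d::finite \<Rightarrow> rat poly"
  assumes fam: "homeo_family X {T}" and "X \<noteq> {}"
  shows "N_infty X T p \<subseteq> seqs_in X"
    and "closed_invariant {T_infty T, shift} (N_infty X T p)"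
proof -
  let ?s = "\<lambda>x k n. omega X T p x (n + k)"
  let ?A = "{?s x k | x k. x \<in> X}"
  have bij: "bij_betw T X X"
    using fam by (rule homeo_family_bij) simp
  then have TX: "T ` X = X"
    by (simp add: bij_betw_def)
  have K: "homeo_family (seqs_in X :: (int \<Rightarrow> 'a ^ 'd) set) {T_infty T, shift}"
    using fam by (rule homeo_family_seqs_in)
  then have cpt: "compact (seqs_in X :: (int \<Rightarrow> 'a ^ 'd) set)"
    by (simp add: homeo_family_def)
  have AK: "?A \<subseteq> seqs_in X"
    using omega_mem_seqs_in[OF bij subset_refl TX, of _ p] by (auto simp: seqs_in_def)
  then show "N_infty X T p \<subseteq> seqs_in X"
    unfolding N_infty_eq using cpt by (simp add: closure_minimal compact_imp_closed)
  have T_s: "T_infty T (?s x k) = ?s (T x) k" if "x \<in> X" for x k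
    using int_iter_Suc(1,2)[OF bij that]
    by (simp add: T_infty_def omega_def fun_eq_iff vec_eq_iff)
  have shift_s: "shift (?s x k) = ?s x (k + 1)" for x k
    by (rule shift_translate)
  have "T_infty T ` ?A = ?A"
  proof (intro equalityI subsetI)
    fix w assume "w \<in> ?A"
    then obtain x k where "x \<in> X" "w = ?s x k"
      by blast
    moreover from this obtain y where "y \<in> X" "x = T y"
      using TX by blast
    ultimately have "w = T_infty T (?s y k)" "?s y k \<in> ?A"
      by (auto simp: T_s)
    then show "w \<in> T_infty T ` ?A"
      by (rule image_eqI)
  next
    fix w assume "w \<in> T_infty T ` ?A"
    then obtain x k where "x \<in> X" "w = T_infty T (?s x k)"
      by blast
    then have "w = ?s (T x) k" "T x \<in> X"
      using TX by (auto simp: T_s)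
    then show "w \<in> ?A"
      by blast
  qed
  moreover have "shift ` ?A = ?A"
  proof (intro equalityI subsetI)
    fix w assume "w \<in> ?A"
    then obtain x k where "x \<in> X" "w = ?s x k"
      by blast
    then have "w = shift (?s x (k - 1))" "?s x (k - 1) \<in> ?A"
      unfolding shift_s by auto
    then show "w \<in> shift ` ?A"
      by (rule image_eqI)
  next
    fix w assume "w \<in> shift ` ?A"
    then obtain x k where "x \<in> X" "w = shift (?s x k)"
      by blast
    then show "w \<in> ?A"
      unfolding shift_s by blast
  qed
  ultimately have "f ` closure ?A = closure ?A" if "f \<in> {T_infty T, shift}" for f
    using that image_closure_invariant[OF cpt AK, of f] K by (auto simp: homeo_family_def)
  moreover have "closure ?A \<noteq> {}"
    using \<open>X \<noteq> {}\<close> by auto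
  ultimately show "closed_invariant {T_infty T, shift} (N_infty X T p)"
    unfolding closed_invariant_def N_infty_eq by blast
qed

section \<open>Comparison of the minimal points\<close>

theorem theoremA:
  fixes X :: "'a::metric_space set" and T :: "'a \<Rightarrow> 'a" and p :: "'d::finite \<Rightarrow> rat poly"
  assumes "top_dyn_system X T"
    and "\<And>i. integral_poly (p i)"
    and "\<And>i. poly (p i) 0 = 0"
  shows "(\<exists>!x. minimal_point X (group_generated_on X {T}) x) \<longleftrightarrow>
         (\<exists>!w. minimal_point (N_infty X T p)
                 (group_generated_on (N_infty X T p) {T_infty T, shift}) w)"
proof -
  let ?N = "N_infty X T p" and ?F = "{T_infty T :: (int \<Rightarrow> 'a ^ 'd) \<Rightarrow> _, shift}"
  have famX: "homeo_family X {T}" and "X \<noteq> {}"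
    using assms(1)
    by (auto simp: top_dyn_system_def homeo_family_def homeomorphism_def intro: inj_on_inverseI)
  have bij: "bij_betw T X X"
    using famX by (rule homeo_family_bij) simp
  have famK: "homeo_family (seqs_in X) ?F"
    using famX by (rule homeo_family_seqs_in)
  have N: "?N \<subseteq> seqs_in X" "closed_invariant ?F ?N"
    using N_infty_closed_invariant[OF famX \<open>X \<noteq> {}\<close>] by auto
  have famN: "homeo_family ?N ?F"
    using famK N(2,1) by (rule homeo_family_subset)
  show ?thesis
    unfolding unique_minimal_point_iff[OF famX] unique_minimal_point_iff[OF famN]
  proof
    assume "\<exists>x\<in>X. minimal_set {T} {x} \<and> (\<forall>M\<subseteq>X. minimal_set {T} M \<longrightarrow> M = {x})"
    then obtain x where x: "x \<in> X" "minimal_set {T} {x}"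
      and uniq: "\<And>M. M \<subseteq> X \<Longrightarrow> minimal_set {T} M \<Longrightarrow> M = {x}"
      by blast
    define c :: "int \<Rightarrow> 'a ^ 'd" where "c = (\<lambda>n. \<chi> i. x)"
    have Tx: "T x = x"
      using x(2) by (auto simp: minimal_set_def closed_invariant_def)
    have "omega X T p x \<in> seqs_in {x}"
      by (rule omega_mem_seqs_in[OF bij]) (use x(1) Tx in auto)
    then have "omega X T p x = c"
      by (auto simp: c_def seqs_in_def fun_eq_iff vec_eq_iff)
    then have cN: "c \<in> ?N"
      using omega_mem_N_infty[OF x(1)] by metis
    have c: "minimal_set ?F {c}"
      by (rule minimal_set_singleton) (use Tx in \<open>auto simp: c_def T_infty_def shift_def\<close>)
    have "M = {c}" if M: "M \<subseteq> ?N" "minimal_set ?F M" for M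
    proof -
      have famM: "homeo_family M {T_infty T}"
        using homeo_family_subset[OF famN _ M(1)] M(2)
        by (simp add: minimal_set_def homeo_family_def)
      have "closed_invariant {T_infty T} M"
        using M(2) by (simp add: minimal_set_def closed_invariant_def)
      then obtain L where L: "minimal_set {T_infty T} L" "L \<subseteq> M"
        using minimal_set_exists[OF famM _ subset_refl] by blast
      have "compact L"
        using homeo_family_subset[OF famM _ L(2)] L(1) by (simp add: minimal_set_def homeo_family_def)
      have LX: "w n $ i \<in> X" if "w \<in> L" for w n i
      proof -
        have "w \<in> seqs_in X"
          using that L(2) M(1) N(1) by (meson subsetD)
        then show ?thesis
          by (simp add: seqs_in_def)
      qed
      have "(\<lambda>w. w n $ i) ` L = {x}" for n i
      proof (rule uniq)
        show "(\<lambda>w. w n $ i) ` L \<subseteq> X"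
          using LX by auto
        then have "inj_on T ((\<lambda>w. w n $ i) ` L)"
          using bij by (auto simp: bij_betw_def intro: inj_on_subset)
        then show "minimal_set {T} ((\<lambda>w. w n $ i) ` L)"
          using L(1) \<open>compact L\<close>
          by (intro minimal_set_image[where f = "T_infty T"] continuous_on_coord)
            (auto simp: T_infty_def)
      qed
      then have "w n $ i = x" if "w \<in> L" for w n i
        using that by blast
      then have "L \<subseteq> {c}"
        by (auto simp: c_def fun_eq_iff vec_eq_iff)
      moreover have "L \<noteq> {}"
        using L(1) by (simp add: minimal_set_def closed_invariant_def)
      ultimately have "{c} \<subseteq> M"
        using L(2) by blast
      then show ?thesis
        using M(2) c by (auto simp: minimal_set_def)
    qed
    then show "\<exists>w\<in>?N. minimal_set ?F {w} \<and> (\<forall>M\<subseteq>?N. minimal_set ?F M \<longrightarrow> M = {w})"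
      using cN c by blast
  next
    assume "\<exists>w\<in>?N. minimal_set ?F {w} \<and> (\<forall>M\<subseteq>?N. minimal_set ?F M \<longrightarrow> M = {w})"
    then obtain w where w: "minimal_set ?F {w}"
      and uniq: "\<And>M. M \<subseteq> ?N \<Longrightarrow> minimal_set ?F M \<Longrightarrow> M = {w}"
      by blast
    \<comment> \<open>The index type is inhabited but has no distinguished element; this names an arbitrary one.\<close>
    define i :: 'd where "i = undefined"
    have "T_infty T w = w"
      using w by (auto simp: minimal_set_def closed_invariant_def)
    then have Tw: "T (w 0 $ i) = w 0 $ i"
      by (auto simp: T_infty_def fun_eq_iff vec_eq_iff)
    have single: "M = {w 0 $ i}" if M: "M \<subseteq> X" "minimal_set {T} M" for M
    proof -
      have Mci: "closed_invariant {T} M"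
        using M(2) by (simp add: minimal_set_def)
      let ?S = "seqs_in M :: (int \<Rightarrow> 'a ^ 'd) set"
      have famS: "homeo_family ?S ?F"
        using homeo_family_subset[OF famX Mci M(1)] by (rule homeo_family_seqs_in)
      have SX: "?S \<subseteq> seqs_in X"
        using M(1) by (auto simp: seqs_in_def)
      obtain x where "x \<in> M"
        using Mci by (auto simp: closed_invariant_def)
      then have "omega X T p x \<in> ?N \<inter> ?S"
        using omega_mem_N_infty[of x X T p] omega_mem_seqs_in[OF bij M(1), of x p] M(1) Mci
        by (auto simp: closed_invariant_def)
      moreover have "closed (?N \<inter> ?S)"
        using N(2) closed_seqs_in[of M] Mci by (auto simp: closed_invariant_def)
      moreover have "f ` (?N \<inter> ?S) = ?N \<inter> ?S" if "f \<in> ?F" for f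
      proof -
        have "inj_on f (seqs_in X)"
          using famK that by (auto simp: homeo_family_def)
        then have "f ` (?N \<inter> ?S) = f ` ?N \<inter> f ` ?S"
          using N(1) SX by (rule inj_on_image_Int)
        then show ?thesis
          using N(2) famS that unfolding closed_invariant_def homeo_family_def by metis
      qed
      ultimately have "closed_invariant ?F (?N \<inter> ?S)"
        unfolding closed_invariant_def by blast
      then obtain L where "minimal_set ?F L" "L \<subseteq> ?N \<inter> ?S"
        by (rule minimal_set_exists[OF famN]) simp
      then have "w \<in> ?S"
        using uniq by blast
      then have "{w 0 $ i} \<subseteq> M"
        by (simp add: seqs_in_def)
      moreover have "minimal_set {T} {w 0 $ i}"
        using Tw by (intro minimal_set_singleton) simp
      ultimately show ?thesis
        using M(2) by (auto simp: minimal_set_def)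
    qed
    have "closed_invariant {T} X"
      using famX \<open>X \<noteq> {}\<close> by (auto simp: closed_invariant_def homeo_family_def compact_imp_closed)
    then obtain M where "minimal_set {T} M" "M \<subseteq> X"
      using minimal_set_exists[OF famX _ subset_refl] by blast
    then show "\<exists>x\<in>X. minimal_set {T} {x} \<and> (\<forall>M\<subseteq>X. minimal_set {T} M \<longrightarrow> M = {x})"
      using single by blast
  qed
qed

end
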